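(* There is a composite adjunction between $\mathbf{Cl}$ and $\mathbf{HypGph}$, given by the following chain, in which all functors in the direction from $\mathbf{Cl}$ to $\mathbf{HypGph}$ are right adjoints: (1) $\mathrm{A}:\mathbf{Cl}\to\mathbf{Cl_A}$ is right adjoint to the inclusion $\mathbf{Cl_A}\hookrightarrow\mathbf{Cl}$; (2) $s:\mathbf{Cl_A}\to\mathbf{Cl_{sA}}$ is right adjoint to the inclusion $\mathbf{Cl_{sA}}\hookrightarrow\mathbf{Cl_A}$; (3) $\Phi:\mathbf{Cl_{sA}}\to\mathbf{Gph}$ is an isomorphism of categories with inverse $\Psi:\mathbf{Gph}\to\mathbf{Cl_{sA}}$; (4) $\mathrm{cosk}_1:\mathbf{Gph}\to\mathbf{Simp}$ is right adjoint to $\mathrm{tr}_1:\mathbf{Simp}\to\mathbf{Gph}$; (5) $\mathrm{cosk}_\infty:\mathbf{Simp}\to\mathbf{HypGph_{dc}}$ is right adjoint to $\mathrm{tr}_\infty:\mathbf{HypGph_{dc}}\to\mathbf{Simp}$; (6) the inclusion $\mathbf{HypGph_{dc}}\hookrightarrow\mathbf{HypGph}$ is right adjoint to $\mathrm{dc}:\mathbf{HypGph}\to\mathbf{HypGph_{dc}}$.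
   Context: A (Čech) closure space $(X,c)$ is a set $X$ with a function $c:2^X\to 2^X$ such that $c(\varnothing)=\varnothing$, $A\subset c(A)$, and $c(A\cup B)=c(A)\cup c(B)$. Write $c(x)$ for $c(\{x\})$. Continuous maps satisfy $f(c_X(A))\subset c_Y(f(A))$; $\mathbf{Cl}$ is the resulting category. $\mathbf{Cl_A}$ is the full subcategory of Alexandroff closure spaces ($c(A)=\bigcup_{a\in A}c(a)$ for all $A$), and $\mathbf{Cl_{sA}}$ the full subcategory of Alexandroff closure spaces that are symmetric ($y\in c(x)\Rightarrow x\in c(y)$). A simple graph $(X,E)$ is a set $X$ with a symmetric relation $E$ disjoint from the diagonal $\Delta$ (equivalently a set of two-element subsets of $X$); $\overline E=E\cup\Delta$; a graph homomorphism $f:(X,E)\to(Y,F)$ satisfies $x\overline Ex'\Rightarrow f(x)\overline Ff(x')$. $\mathbf{Gph}$ is the resulting category. A hypergraph $(X,E)$ is a set $X$ with a collection $E$ of nonempty subsets (hyperedges); homomorphisms are maps $f$ with $f(e)\in F$ for all $e\in E$; category $\mathbf{HypGph}$. It is downward closed if $\varnothing\ne\sigma\subset\tau\in E$ implies $\sigma\in E$, and $\{x\}\in E$ for all $x\in X$; full subcategory $\mathbf{HypGph_{dc}}$. A simplicial complex is a downward closed hypergraph all of whose hyperedges are finite; full subcategory $\mathbf{Simp}$. Functors (all the identity on underlying set maps): $\mathrm{A}(X,c)=(X,\mathrm{A}(c))$, $\mathrm{A}(c)(B)=\bigcup_{b\in B}c(b)$. $s(X,c)=(X,s(c))$, the Alexandroff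 closure with $s(c)(x)=\{y\in c(x)\mid x\in c(y)\}$. $\Phi(X,c)=(X,E_c)$ with $x\overline{E}_cy\iff y\in c(x)$; $\Psi(X,E)=(X,c_E)$ with $c_E(A)=\{y\mid\exists x\in A,\ x\overline Ey\}$. $\mathrm{tr}_1(X,E)=(X,\{\sigma\in E\mid|\sigma|=2\})$; $\mathrm{cosk}_1(X,E)$ has simplices all nonempty finite $\tau\subset X$ such that $\{x,y\}\in E$ for all distinct $x,y\in\tau$. $\mathrm{tr}_\infty(X,E)=(X,\{\sigma\in E\mid|\sigma|<\infty\})$; $\mathrm{cosk}_\infty(X,E)$ has hyperedges all nonempty $\tau\subset X$ all of whose nonempty finite subsets lie in $E$. $\mathrm{dc}(X,E)$ has hyperedges all nonempty subsets of elements of $E$ and all singletons $\{x\}$, $x\in X$. *)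

theory Defs
  imports "HOL-Library.FuncSet"
begin

section \<open>Categories, functors, adjunctions\<close>

record ('o, 'm) cat =
  Ob :: "'o set"
  Hom :: "'o \<Rightarrow> 'o \<Rightarrow> 'm set"
  Ident :: "'o \<Rightarrow> 'm"
  Comp :: "'m \<Rightarrow> 'm \<Rightarrow> 'm"

text \<open>\<open>Comp C g f\<close> is the composite "g after f".\<close>

definition category :: "('o, 'm) cat \<Rightarrow> bool" where
  "category C \<longleftrightarrow>
     (\<forall>A\<in>Ob C. Ident C A \<in> Hom C A A) \<and>
     (\<forall>A\<in>Ob C. \<forall>B\<in>Ob C. \<forall>D\<in>Ob C. \<forall>f\<in>Hom C A B. \<forall>g\<in>Hom C B D. Comp C g f \<in> Hom C A D) \<and>
     (\<forall>A\<in>Ob C. \<forall>B\<in>Ob C. \<forall>f\<in>Hom C A B. Comp C f (Ident C A) = f \<and> Comp C (Ident C B) f = f) \<and>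
     (\<forall>A\<in>Ob C. \<forall>B\<in>Ob C. \<forall>D\<in>Ob C. \<forall>E\<in>Ob C. \<forall>f\<in>Hom C A B. \<forall>g\<in>Hom C B D. \<forall>h\<in>Hom C D E.
        Comp C h (Comp C g f) = Comp C (Comp C h g) f) \<and>
     (\<forall>A\<in>Ob C. \<forall>B\<in>Ob C. \<forall>A'\<in>Ob C. \<forall>B'\<in>Ob C.
        Hom C A B \<inter> Hom C A' B' \<noteq> {} \<longrightarrow> A = A' \<and> B = B')"

definition full_subcat :: "('o, 'm) cat \<Rightarrow> ('o \<Rightarrow> bool) \<Rightarrow> ('o, 'm) cat" where
  "full_subcat C P = C\<lparr>Ob := {A \<in> Ob C. P A}\<rparr>"

record ('o, 'm, 'p, 'n) fctr =
  on_ob :: "'o \<Rightarrow> 'p"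
  on_arr :: "'m \<Rightarrow> 'n"

definition is_functor :: "('o, 'm) cat \<Rightarrow> ('p, 'n) cat \<Rightarrow> ('o, 'm, 'p, 'n) fctr \<Rightarrow> bool" where
  "is_functor C D F \<longleftrightarrow> category C \<and> category D \<and>
     (\<forall>A\<in>Ob C. on_ob F A \<in> Ob D) \<and>
     (\<forall>A\<in>Ob C. \<forall>B\<in>Ob C. \<forall>f\<in>Hom C A B. on_arr F f \<in> Hom D (on_ob F A) (on_ob F B)) \<and>
     (\<forall>A\<in>Ob C. on_arr F (Ident C A) = Ident D (on_ob F A)) \<and>
     (\<forall>A\<in>Ob C. \<forall>B\<in>Ob C. \<forall>E\<in>Ob C. \<forall>f\<in>Hom C A B. \<forall>g\<in>Hom C B E.
        on_arr F (Comp C g f) = Comp D (on_arr F g) (on_arr F f))"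

definition fctr_comp ::
    "('p, 'n, 'q, 'l) fctr \<Rightarrow> ('o, 'm, 'p, 'n) fctr \<Rightarrow> ('o, 'm, 'q, 'l) fctr" (infixr "\<circ>\<^sub>F" 70) where
  "G \<circ>\<^sub>F F = \<lparr>on_ob = on_ob G \<circ> on_ob F, on_arr = on_arr G \<circ> on_arr F\<rparr>"

text \<open>The inclusion functor of a full subcategory.\<close>

definition incl :: "('o, 'm, 'o, 'm) fctr" where
  "incl = \<lparr>on_ob = (\<lambda>A. A), on_arr = (\<lambda>f. f)\<rparr>"

definition inverse_functors ::
    "('o, 'm) cat \<Rightarrow> ('p, 'n) cat \<Rightarrow> ('o, 'm, 'p, 'n) fctr \<Rightarrow> ('p, 'n, 'o, 'm) fctr \<Rightarrow> bool" where
  "inverse_functors C D F G \<longleftrightarrow> is_functor C D F \<and> is_functor D C G \<and>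
     (\<forall>A\<in>Ob C. on_ob G (on_ob F A) = A) \<and>
     (\<forall>A\<in>Ob C. \<forall>B\<in>Ob C. \<forall>f\<in>Hom C A B. on_arr G (on_arr F f) = f) \<and>
     (\<forall>A\<in>Ob D. on_ob F (on_ob G A) = A) \<and>
     (\<forall>A\<in>Ob D. \<forall>B\<in>Ob D. \<forall>f\<in>Hom D A B. on_arr F (on_arr G f) = f)"

text \<open>\<open>right_adjoint C D R L\<close>: the functor \<open>R : C \<rightarrow> D\<close> is right adjoint to \<open>L : D \<rightarrow> C\<close>, i.e. there are
  bijections \<open>Hom C (L X) Y \<cong> Hom D X (R Y)\<close> natural in \<open>X\<close> and \<open>Y\<close>.\<close>

definition right_adjoint ::
    "('o, 'm) cat \<Rightarrow> ('p, 'n) cat \<Rightarrow> ('o, 'm, 'p, 'n) fctr \<Rightarrow> ('p, 'n, 'o, 'm) fctr \<Rightarrow> bool" where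
  "right_adjoint C D R L \<longleftrightarrow> is_functor C D R \<and> is_functor D C L \<and>
     (\<exists>\<phi>.
       (\<forall>X\<in>Ob D. \<forall>Y\<in>Ob C. bij_betw (\<phi> X Y) (Hom C (on_ob L X) Y) (Hom D X (on_ob R Y))) \<and>
       (\<forall>X\<in>Ob D. \<forall>X'\<in>Ob D. \<forall>Y\<in>Ob C. \<forall>Y'\<in>Ob C.
         \<forall>h\<in>Hom D X' X. \<forall>k\<in>Hom C Y Y'. \<forall>g\<in>Hom C (on_ob L X) Y.
           \<phi> X' Y' (Comp C k (Comp C g (on_arr L h))) =
             Comp D (on_arr R k) (Comp D (\<phi> X Y g) h)))"


section \<open>Categories of structured sets\<close>

text \<open>Objects are pairs \<open>(X, S)\<close> of a carrier \<open>X :: 'a set\<close> and a structure \<open>S\<close>; the (arbitrary) type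
  \<open>'a\<close> plays the role of a universe. An arrow is a triple (source, map, target), where the map is
  extensional on the carrier of the source, so that equal set maps give equal arrows.\<close>

type_synonym ('a, 's) obj = "'a set \<times> 's"
type_synonym ('a, 's) arr = "('a, 's) obj \<times> ('a \<Rightarrow> 'a) \<times> ('a, 's) obj"

definition concrete_cat ::
    "('a, 's) obj set \<Rightarrow> (('a, 's) obj \<Rightarrow> ('a, 's) obj \<Rightarrow> ('a \<Rightarrow> 'a) \<Rightarrow> bool) \<Rightarrow>
     (('a, 's) obj, ('a, 's) arr) cat" where
  "concrete_cat Obs is_mor =
     \<lparr>Ob = Obs,
      Hom = (\<lambda>A B. {(A, f, B) |f. f \<in> fst A \<rightarrow>\<^sub>E fst B \<and> is_mor A B f}),
      Ident = (\<lambda>A. (A, (\<lambda>x\<in>fst A. x), A)),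
      Comp = (\<lambda>(_, g, C) (A, f, _). (A, compose (fst A) g f, C))\<rparr>"

text \<open>The functor which acts by \<open>F\<close> on objects and is the identity on underlying set maps.\<close>

definition concrete_functor ::
    "(('a, 's) obj \<Rightarrow> ('a, 't) obj) \<Rightarrow> (('a, 's) obj, ('a, 's) arr, ('a, 't) obj, ('a, 't) arr) fctr" where
  "concrete_functor F = \<lparr>on_ob = F, on_arr = (\<lambda>(A, f, B). (F A, f, F B))\<rparr>"


section \<open>Closure spaces\<close>

type_synonym 'a closure = "('a, 'a set \<Rightarrow> 'a set) obj"
type_synonym 'a closure_cat = "('a closure, ('a, 'a set \<Rightarrow> 'a set) arr) cat"

definition closure_space :: "'a closure \<Rightarrow> bool" where
  "closure_space = (\<lambda>(X, c).
     c \<in> Pow X \<rightarrow>\<^sub>E Pow X \<and> c {} = {} \<and>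
     (\<forall>A\<subseteq>X. A \<subseteq> c A) \<and>
     (\<forall>A\<subseteq>X. \<forall>B\<subseteq>X. c (A \<union> B) = c A \<union> c B))"

definition continuous_map :: "'a closure \<Rightarrow> 'a closure \<Rightarrow> ('a \<Rightarrow> 'a) \<Rightarrow> bool" where
  "continuous_map = (\<lambda>(X, c) (Y, d) f. \<forall>A\<subseteq>X. f ` c A \<subseteq> d (f ` A))"

definition alexandroff :: "'a closure \<Rightarrow> bool" where
  "alexandroff = (\<lambda>(X, c). \<forall>A\<subseteq>X. c A = (\<Union>a\<in>A. c {a}))"

definition symmetric :: "'a closure \<Rightarrow> bool" where
  "symmetric = (\<lambda>(X, c). \<forall>x\<in>X. \<forall>y\<in>X. y \<in> c {x} \<longrightarrow> x \<in> c {y})"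

definition Cl :: "'a closure_cat" where
  "Cl = concrete_cat {A. closure_space A} continuous_map"

definition Cl_A :: "'a closure_cat" where
  "Cl_A = full_subcat Cl alexandroff"

definition Cl_sA :: "'a closure_cat" where
  "Cl_sA = full_subcat Cl (\<lambda>A. alexandroff A \<and> symmetric A)"

definition A_ob :: "'a closure \<Rightarrow> 'a closure" where
  "A_ob = (\<lambda>(X, c). (X, \<lambda>B\<in>Pow X. \<Union>b\<in>B. c {b}))"

definition s_ob :: "'a closure \<Rightarrow> 'a closure" where
  "s_ob = (\<lambda>(X, c). (X, \<lambda>B\<in>Pow X. \<Union>x\<in>B. {y \<in> c {x}. x \<in> c {y}}))"


section \<open>Simple graphs\<close>

type_synonym 'a graph = "('a, 'a rel) obj"
type_synonym 'a graph_cat = "('a graph, ('a, 'a rel) arr) cat"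

definition simple_graph :: "'a graph \<Rightarrow> bool" where
  "simple_graph = (\<lambda>(X, E). E \<subseteq> X \<times> X \<and> sym E \<and> E \<inter> Id_on X = {})"

text \<open>\<open>E \<union> Id_on X\<close> is the reflexive closure of the edge relation.\<close>

definition reflE :: "'a graph \<Rightarrow> 'a rel" where
  "reflE = (\<lambda>(X, E). E \<union> Id_on X)"

definition graph_hom :: "'a graph \<Rightarrow> 'a graph \<Rightarrow> ('a \<Rightarrow> 'a) \<Rightarrow> bool" where
  "graph_hom G H f \<longleftrightarrow> (\<forall>x x'. (x, x') \<in> reflE G \<longrightarrow> (f x, f x') \<in> reflE H)"

definition Gph :: "'a graph_cat" where
  "Gph = concrete_cat {G. simple_graph G} graph_hom"

definition Phi_ob :: "'a closure \<Rightarrow> 'a graph" where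
  "Phi_ob = (\<lambda>(X, c). (X, {(x, y) \<in> X \<times> X. y \<in> c {x}} - Id_on X))"

definition Psi_ob :: "'a graph \<Rightarrow> 'a closure" where
  "Psi_ob = (\<lambda>(X, E). (X, \<lambda>A\<in>Pow X. {y. \<exists>x\<in>A. (x, y) \<in> reflE (X, E)}))"


section \<open>Hypergraphs and simplicial complexes\<close>

type_synonym 'a hypergraph = "('a, 'a set set) obj"
type_synonym 'a hypergraph_cat = "('a hypergraph, ('a, 'a set set) arr) cat"

definition is_hypergraph :: "'a hypergraph \<Rightarrow> bool" where
  "is_hypergraph = (\<lambda>(X, E). E \<subseteq> Pow X - {{}})"

definition hypergraph_hom :: "'a hypergraph \<Rightarrow> 'a hypergraph \<Rightarrow> ('a \<Rightarrow> 'a) \<Rightarrow> bool" where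
  "hypergraph_hom = (\<lambda>(X, E) (Y, F) f. \<forall>e\<in>E. f ` e \<in> F)"

definition downward_closed :: "'a hypergraph \<Rightarrow> bool" where
  "downward_closed = (\<lambda>(X, E).
     (\<forall>\<tau>\<in>E. \<forall>\<sigma>. \<sigma> \<noteq> {} \<and> \<sigma> \<subseteq> \<tau> \<longrightarrow> \<sigma> \<in> E) \<and> (\<forall>x\<in>X. {x} \<in> E))"

definition simplicial_complex :: "'a hypergraph \<Rightarrow> bool" where
  "simplicial_complex H \<longleftrightarrow> downward_closed H \<and> (\<forall>e\<in>snd H. finite e)"

definition HypGph :: "'a hypergraph_cat" where
  "HypGph = concrete_cat {H. is_hypergraph H} hypergraph_hom"

definition HypGph_dc :: "'a hypergraph_cat" where
  "HypGph_dc = full_subcat HypGph downward_closed"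

definition Simp :: "'a hypergraph_cat" where
  "Simp = full_subcat HypGph simplicial_complex"

text \<open>Since graphs are given by edge relations here, a set of two-element subsets is read as the
  relation "\<open>x \<noteq> y\<close> and \<open>{x, y}\<close> is a member", and \<open>{x, y} \<in> E\<close> for distinct \<open>x\<close>, \<open>y\<close> as \<open>(x, y) \<in> E\<close>.\<close>

definition rel_of_edges :: "'a set set \<Rightarrow> 'a rel" where
  "rel_of_edges S = {(x, y). x \<noteq> y \<and> {x, y} \<in> S}"

definition tr1_ob :: "'a hypergraph \<Rightarrow> 'a graph" where
  "tr1_ob = (\<lambda>(X, E). (X, rel_of_edges {\<sigma> \<in> E. card \<sigma> = 2}))"

definition cosk1_ob :: "'a graph \<Rightarrow> 'a hypergraph" where
  "cosk1_ob = (\<lambda>(X, E). (X, {\<tau>. \<tau> \<subseteq> X \<and> \<tau> \<noteq> {} \<and> finite \<tau> \<and>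
     (\<forall>x\<in>\<tau>. \<forall>y\<in>\<tau>. x \<noteq> y \<longrightarrow> (x, y) \<in> E)}))"

definition tr_inf_ob :: "'a hypergraph \<Rightarrow> 'a hypergraph" where
  "tr_inf_ob = (\<lambda>(X, E). (X, {\<sigma> \<in> E. finite \<sigma>}))"

definition cosk_inf_ob :: "'a hypergraph \<Rightarrow> 'a hypergraph" where
  "cosk_inf_ob = (\<lambda>(X, E). (X, {\<tau>. \<tau> \<subseteq> X \<and> \<tau> \<noteq> {} \<and>
     (\<forall>\<sigma>. \<sigma> \<subseteq> \<tau> \<and> \<sigma> \<noteq> {} \<and> finite \<sigma> \<longrightarrow> \<sigma> \<in> E)}))"

definition dc_ob :: "'a hypergraph \<Rightarrow> 'a hypergraph" where
  "dc_ob = (\<lambda>(X, E). (X, {\<sigma>. \<sigma> \<noteq> {} \<and> (\<exists>e\<in>E. \<sigma> \<subseteq> e)} \<union> {{x} |x. x \<in> X}))"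


section \<open>The functors\<close>

abbreviation "A_fun \<equiv> concrete_functor A_ob"
abbreviation "s_fun \<equiv> concrete_functor s_ob"
abbreviation "Phi \<equiv> concrete_functor Phi_ob"
abbreviation "Psi \<equiv> concrete_functor Psi_ob"
abbreviation "tr1 \<equiv> concrete_functor tr1_ob"
abbreviation "cosk1 \<equiv> concrete_functor cosk1_ob"
abbreviation "tr_inf \<equiv> concrete_functor tr_inf_ob"
abbreviation "cosk_inf \<equiv> concrete_functor cosk_inf_ob"
abbreviation "dc \<equiv> concrete_functor dc_ob"

end

(* All the functors involved are the identity on maps, so each adjunction amounts to one equivalence:
   f is a morphism L X -> Y iff f is a morphism X -> R Y. Applied to identity maps this equivalence
   gives the unit and the counit, hence also the functoriality of L and R. For the closure-space
   adjunctions the equivalence is checked on points, since continuity out of an Alexandroff space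
   is. *)
theory Submission
  imports Defs
begin

section \<open>Composition of adjunctions\<close>

lemma is_functor_comp:
  assumes "is_functor C D F" and "is_functor D E G"
  shows "is_functor C E (G \<circ>\<^sub>F F)"
proof -
  have "on_arr G (Comp D (on_arr F g) (on_arr F f)) =
      Comp E (on_arr G (on_arr F g)) (on_arr G (on_arr F f))"
    if "X \<in> Ob C" "Y \<in> Ob C" "Z \<in> Ob C" "f \<in> Hom C X Y" "g \<in> Hom C Y Z" for X Y Z f g
  proof -
    have "on_ob F X \<in> Ob D" "on_ob F Y \<in> Ob D" "on_ob F Z \<in> Ob D"
      "on_arr F f \<in> Hom D (on_ob F X) (on_ob F Y)" "on_arr F g \<in> Hom D (on_ob F Y) (on_ob F Z)"
      using assms(1) that by (simp_all add: is_functor_def)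
    then show ?thesis
      using assms(2) unfolding is_functor_def by blast
  qed
  then show ?thesis
    using assms unfolding is_functor_def fctr_comp_def by simp
qed

text \<open>Arrows are transposed twice, \<open>L (L' X) \<rightarrow> Y\<close> to
  \<open>L' X \<rightarrow> R Y\<close> to \<open>X \<rightarrow> R' (R Y)\<close>. Naturality is
  \<open>nat\<close> at \<open>L' h\<close> followed by \<open>nat'\<close> at
  \<open>R k\<close>.\<close>

lemma right_adjoint_comp:
  assumes R: "right_adjoint C D R L" and R': "right_adjoint D E R' L'"
  shows "right_adjoint C E (R' \<circ>\<^sub>F R) (L \<circ>\<^sub>F L')"
proof -
  have fR: "is_functor C D R" and fL: "is_functor D C L"
    and fR': "is_functor D E R'" and fL': "is_functor E D L'"
    using R R' by (simp_all add: right_adjoint_def)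
  obtain \<phi> where
    bij: "\<And>X Y. X \<in> Ob D \<Longrightarrow> Y \<in> Ob C \<Longrightarrow>
      bij_betw (\<phi> X Y) (Hom C (on_ob L X) Y) (Hom D X (on_ob R Y))" and
    nat: "\<And>X X' Y Y' h k g. X \<in> Ob D \<Longrightarrow> X' \<in> Ob D \<Longrightarrow> Y \<in> Ob C \<Longrightarrow> Y' \<in> Ob C \<Longrightarrow>
      h \<in> Hom D X' X \<Longrightarrow> k \<in> Hom C Y Y' \<Longrightarrow> g \<in> Hom C (on_ob L X) Y \<Longrightarrow>
      \<phi> X' Y' (Comp C k (Comp C g (on_arr L h))) = Comp D (on_arr R k) (Comp D (\<phi> X Y g) h)"
    using R unfolding right_adjoint_def by blast
  obtain \<psi> where
    bij': "\<And>X Y. X \<in> Ob E \<Longrightarrow> Y \<in> Ob D \<Longrightarrow>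
      bij_betw (\<psi> X Y) (Hom D (on_ob L' X) Y) (Hom E X (on_ob R' Y))" and
    nat': "\<And>X X' Y Y' h k g. X \<in> Ob E \<Longrightarrow> X' \<in> Ob E \<Longrightarrow> Y \<in> Ob D \<Longrightarrow> Y' \<in> Ob D \<Longrightarrow>
      h \<in> Hom E X' X \<Longrightarrow> k \<in> Hom D Y Y' \<Longrightarrow> g \<in> Hom D (on_ob L' X) Y \<Longrightarrow>
      \<psi> X' Y' (Comp D k (Comp D g (on_arr L' h))) = Comp E (on_arr R' k) (Comp E (\<psi> X Y g) h)"
    using R' unfolding right_adjoint_def by blast
  have R_ob: "on_ob R Y \<in> Ob D" if "Y \<in> Ob C" for Y
    using fR that by (simp add: is_functor_def)
  have L'_ob: "on_ob L' X \<in> Ob D" if "X \<in> Ob E" for X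
    using fL' that by (simp add: is_functor_def)
  have R_arr: "on_arr R k \<in> Hom D (on_ob R Y) (on_ob R Y')"
    if "Y \<in> Ob C" "Y' \<in> Ob C" "k \<in> Hom C Y Y'" for Y Y' k
    using fR that by (simp add: is_functor_def)
  have L'_arr: "on_arr L' h \<in> Hom D (on_ob L' X') (on_ob L' X)"
    if "X \<in> Ob E" "X' \<in> Ob E" "h \<in> Hom E X' X" for X X' h
    using fL' that by (simp add: is_functor_def)
  define \<chi> where "\<chi> X Y = \<psi> X (on_ob R Y) \<circ> \<phi> (on_ob L' X) Y" for X Y
  have "bij_betw (\<chi> X Y) (Hom C (on_ob L (on_ob L' X)) Y) (Hom E X (on_ob R' (on_ob R Y)))"
    if "X \<in> Ob E" "Y \<in> Ob C" for X Y
    unfolding \<chi>_def using that by (intro bij_betw_trans[OF bij bij'] R_ob L'_ob)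
  moreover have "\<chi> X' Y' (Comp C k (Comp C g (on_arr L (on_arr L' h)))) =
      Comp E (on_arr R' (on_arr R k)) (Comp E (\<chi> X Y g) h)"
    if "X \<in> Ob E" "X' \<in> Ob E" "Y \<in> Ob C" "Y' \<in> Ob C"
      "h \<in> Hom E X' X" "k \<in> Hom C Y Y'" "g \<in> Hom C (on_ob L (on_ob L' X)) Y" for X X' Y Y' h k g
  proof -
    \<comment> \<open>\<open>nat'\<close> speaks only about members of the hom-set, so the once
      transposed arrow has to be located in it.\<close>
    have "\<phi> (on_ob L' X) Y g \<in> Hom D (on_ob L' X) (on_ob R Y)"
      using bij_betwE[OF bij[OF L'_ob]] that by blast
    then show ?thesis
      using that by (simp add: \<chi>_def nat[OF L'_ob L'_ob _ _ L'_arr] nat'[OF _ _ R_ob R_ob _ R_arr])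
  qed
  ultimately show ?thesis
    using is_functor_comp[OF fR fR'] is_functor_comp[OF fL' fL]
    unfolding right_adjoint_def by (auto simp: fctr_comp_def intro!: exI[of _ \<chi>])
qed


section \<open>Concrete categories\<close>

text \<open>Only these two conditions involve the structures. Unit laws and associativity are those
  of extensional maps, and hom-sets are disjoint because arrows record source and target.\<close>

locale concrete_category =
  fixes Obs :: "('a, 's) obj set" and is_mor :: "('a, 's) obj \<Rightarrow> ('a, 's) obj \<Rightarrow> ('a \<Rightarrow> 'a) \<Rightarrow> bool"
  assumes mor_id: "A \<in> Obs \<Longrightarrow> is_mor A A (\<lambda>x\<in>fst A. x)"
    and mor_comp: "\<lbrakk>A \<in> Obs; B \<in> Obs; C \<in> Obs; f \<in> fst A \<rightarrow>\<^sub>E fst B; g \<in> fst B \<rightarrow>\<^sub>E fst C;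
      is_mor A B f; is_mor B C g\<rbrakk> \<Longrightarrow> is_mor A C (compose (fst A) g f)"
begin

lemma category: "category (concrete_cat Obs is_mor)"
proof -
  \<comment> \<open>The unit laws rest on \<open>f\<close> being extensional. Associativity needs
    \<open>f\<close> to land in \<open>T\<close>, outside of which \<open>compose T h g\<close> is
    undefined.\<close>
  have "compose S f (\<lambda>x\<in>S. x) = f" "compose S (\<lambda>x\<in>T. x) f = f"
    if "f \<in> S \<rightarrow>\<^sub>E T" for S T and f :: "'a \<Rightarrow> 'a"
    using that by (auto simp: compose_def fun_eq_iff PiE_def extensional_def)
  moreover have "compose S h (compose S g f) = compose S (compose T h g) f"
    if "f \<in> S \<rightarrow>\<^sub>E T" for S T and f g h :: "'a \<Rightarrow> 'a"
    using that by (auto simp: compose_def fun_eq_iff)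
  moreover have "compose S g f \<in> S \<rightarrow>\<^sub>E U" if "f \<in> S \<rightarrow>\<^sub>E T" "g \<in> T \<rightarrow>\<^sub>E U"
    for S T U and f g :: "'a \<Rightarrow> 'a"
    using that by (auto simp: compose_def)
  moreover have "is_mor (S, s) (U, u) (compose S g f)"
    if "(S, s) \<in> Obs" "(T, t) \<in> Obs" "(U, u) \<in> Obs" "f \<in> S \<rightarrow>\<^sub>E T" "g \<in> T \<rightarrow>\<^sub>E U"
      "is_mor (S, s) (T, t) f" "is_mor (T, t) (U, u) g" for S T U s t u f g
    using mor_comp[of "(S, s)" "(T, t)" "(U, u)" f g] that by simp
  moreover have "is_mor (S, s) (S, s) (\<lambda>x\<in>S. x)" if "(S, s) \<in> Obs" for S s
    using mor_id[OF that] by simp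
  ultimately show ?thesis
    unfolding category_def concrete_cat_def
    by (auto 0 3 del: PiE_I)
qed

lemma subcategory: "concrete_category {A \<in> Obs. P A} is_mor"
  by unfold_locales (auto intro: mor_id mor_comp)

end

lemma full_subcat_concrete_cat:
  "full_subcat (concrete_cat Obs is_mor) P = concrete_cat {A \<in> Obs. P A} is_mor"
  by (simp add: full_subcat_def concrete_cat_def)

text \<open>Lets inclusions enter the general lemmas as one of the two adjoint functors.\<close>

lemma incl_eq_concrete_functor: "incl = concrete_functor (\<lambda>A. A)"
  by (auto simp: incl_def concrete_functor_def)

lemma is_functor_concrete_functor:
  assumes "concrete_category C m" "concrete_category D n"
    and "\<And>A. A \<in> C \<Longrightarrow> F A \<in> D" "\<And>A. A \<in> C \<Longrightarrow> fst (F A) = fst A"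
    and "\<And>A B f. \<lbrakk>A \<in> C; B \<in> C; f \<in> fst A \<rightarrow>\<^sub>E fst B; m A B f\<rbrakk> \<Longrightarrow> n (F A) (F B) f"
  shows "is_functor (concrete_cat C m) (concrete_cat D n) (concrete_functor F)"
  using assms concrete_category.category[OF assms(1)] concrete_category.category[OF assms(2)]
  unfolding is_functor_def by (auto simp: concrete_cat_def concrete_functor_def)

context
  fixes C :: "('a, 's) obj set" and m and D :: "('a, 't) obj set" and n and F G
  assumes C: "concrete_category C m" and D: "concrete_category D n"
    and F: "\<And>Y. Y \<in> C \<Longrightarrow> F Y \<in> D" "\<And>Y. Y \<in> C \<Longrightarrow> fst (F Y) = fst Y"
    and G: "\<And>X. X \<in> D \<Longrightarrow> G X \<in> C" "\<And>X. X \<in> D \<Longrightarrow> fst (G X) = fst X"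
    and adj: "\<And>X Y f. \<lbrakk>X \<in> D; Y \<in> C; f \<in> fst X \<rightarrow>\<^sub>E fst Y\<rbrakk> \<Longrightarrow> m (G X) Y f \<longleftrightarrow> n X (F Y) f"
begin

text \<open>By \<open>adj\<close>, the claim says that \<open>f\<close> is a morphism from
  \<open>G (F A)\<close> to \<open>B\<close>, and it is one as the composite of the counit at
  \<open>A\<close> with \<open>f\<close>.\<close>

lemma right_functor: "is_functor (concrete_cat C m) (concrete_cat D n) (concrete_functor F)"
proof (rule is_functor_concrete_functor[of C m D n F, OF C D])
  fix A B f assume A: "A \<in> C" and B: "B \<in> C" and f: "f \<in> fst A \<rightarrow>\<^sub>E fst B" and "m A B f"
  have counit: "m (G (F A)) A (\<lambda>x\<in>fst A. x)"
    using adj[of "F A" A] concrete_category.mor_id[OF D, of "F A"] A by (simp add: F)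
  have "m (G (F A)) B (compose (fst (G (F A))) f (\<lambda>x\<in>fst A. x))"
    using concrete_category.mor_comp[OF C, of "G (F A)" A B "\<lambda>x\<in>fst A. x" f]
      A B f counit \<open>m A B f\<close> by (simp add: F G)
  moreover have "compose (fst (G (F A))) f (\<lambda>x\<in>fst A. x) = f"
    using f A by (auto simp: F G compose_def fun_eq_iff PiE_def extensional_def)
  ultimately show "n (F A) (F B) f"
    using adj[of "F A" B f] A B f by (simp add: F)
qed (simp_all add: F)

text \<open>Dual to \<open>right_functor\<close>: by \<open>adj\<close>, \<open>f\<close> must be a
  morphism from \<open>A\<close> to \<open>F (G B)\<close>, and it is \<open>f\<close> followed by
  the unit at \<open>B\<close>.\<close>

lemma left_functor: "is_functor (concrete_cat D n) (concrete_cat C m) (concrete_functor G)"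
proof (rule is_functor_concrete_functor[of D n C m G, OF D C])
  fix A B f assume A: "A \<in> D" and B: "B \<in> D" and f: "f \<in> fst A \<rightarrow>\<^sub>E fst B" and "n A B f"
  have unit: "n B (F (G B)) (\<lambda>x\<in>fst B. x)"
    using adj[of B "G B"] concrete_category.mor_id[OF C, of "G B"] B by (simp add: G)
  have "n A (F (G B)) (compose (fst A) (\<lambda>x\<in>fst B. x) f)"
    using concrete_category.mor_comp[OF D, of A B "F (G B)" f "\<lambda>x\<in>fst B. x"]
      A B f unit \<open>n A B f\<close> by (simp add: F G)
  moreover have "compose (fst A) (\<lambda>x\<in>fst B. x) f = f"
    using f by (auto simp: compose_def fun_eq_iff PiE_def extensional_def)
  ultimately show "m (G A) (G B) f"
    using adj[of A "G B" f] A B f by (simp add: G)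
qed (simp_all add: G)

lemma right_adjoint_concrete_functor:
  "right_adjoint (concrete_cat C m) (concrete_cat D n) (concrete_functor F) (concrete_functor G)"
proof -
  \<comment> \<open>Transposition keeps the map and replaces only source and target. Both sides of
    the naturality equation then carry the same composite map.\<close>
  define \<phi> where
    "\<phi> = (\<lambda>X Y (a :: ('a, 's) arr). (X :: ('a, 't) obj, fst (snd a), F Y))"
  have "bij_betw (\<phi> X Y) (Hom (concrete_cat C m) (G X) Y) (Hom (concrete_cat D n) X (F Y))"
    if "X \<in> D" "Y \<in> C" for X Y
    by (rule bij_betw_byWitness[where f' = "\<lambda>a. (G X, fst (snd a), Y)"])
      (use that F(2) G(2) in \<open>auto simp: concrete_cat_def \<phi>_def adj\<close>)
  then show ?thesis
    using right_functor left_functor unfolding right_adjoint_def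
    by (auto simp: concrete_cat_def concrete_functor_def \<phi>_def G(2) intro!: exI[of _ \<phi>])
qed

text \<open>Both functors keep underlying maps, so being inverse on objects makes them inverse on
  arrows.\<close>

lemma inverse_functors_concrete_functor:
  assumes "\<And>Y. Y \<in> C \<Longrightarrow> G (F Y) = Y" "\<And>X. X \<in> D \<Longrightarrow> F (G X) = X"
  shows "inverse_functors (concrete_cat C m) (concrete_cat D n)
    (concrete_functor F) (concrete_functor G)"
  using right_functor left_functor assms unfolding inverse_functors_def
  by (auto simp: concrete_cat_def concrete_functor_def)

end


section \<open>Closure spaces and graphs\<close>

lemma closure_space_mono:
  assumes "closure_space (X, c)" "A \<subseteq> B" "B \<subseteq> X"
  shows "c A \<subseteq> c B"
proof -
  have "c (A \<union> B) = c A \<union> c B"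
    using assms by (auto simp: closure_space_def)
  then show ?thesis
    using assms(2) by (simp add: Un_absorb1 sup.absorb_iff2)
qed

lemma closure_space_subset: "closure_space (X, c) \<Longrightarrow> A \<subseteq> X \<Longrightarrow> c A \<subseteq> X"
  by (auto simp: closure_space_def PiE_iff Pi_iff)

lemma closure_space_point: "closure_space (X, c) \<Longrightarrow> x \<in> X \<Longrightarrow> y \<in> c {x} \<Longrightarrow> y \<in> X"
  using closure_space_subset[of X c "{x}"] by blast

lemma closure_space_refl: "closure_space (X, c) \<Longrightarrow> x \<in> X \<Longrightarrow> x \<in> c {x}"
  unfolding closure_space_def by (auto dest!: spec[of _ "{x}"])

lemma closure_space_extensional: "closure_space (X, c) \<Longrightarrow> c \<in> extensional (Pow X)"
  by (auto simp: closure_space_def PiE_def)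

text \<open>The closures of \<open>A_ob\<close>, \<open>s_ob\<close> and \<open>Psi_ob\<close> are
  all unions of point closures \<open>N x\<close>. Such unions are additive and send the empty set
  to itself, which leaves conditions on single points.\<close>

lemma closure_space_pointwise:
  assumes "\<And>x. x \<in> X \<Longrightarrow> x \<in> N x \<and> N x \<subseteq> X"
  shows "closure_space (X, \<lambda>A\<in>Pow X. \<Union>x\<in>A. N x)"
  using assms by (auto simp: closure_space_def)

lemma alexandroff_pointwise: "alexandroff (X, \<lambda>A\<in>Pow X. \<Union>x\<in>A. N x)"
  by (auto simp: alexandroff_def)

text \<open>One direction specialises to singletons. For the other, a point of \<open>c A\<close>
  lies in some \<open>c {x}\<close> with \<open>x \<in> A\<close>; as \<open>d\<close> may fail to
  be Alexandroff, monotonicity carries \<open>d {f x}\<close> into the closure of the image of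
  \<open>A\<close>.\<close>

lemma alexandroff_continuous_iff:
  assumes X: "closure_space (X, c)" "alexandroff (X, c)" and Y: "closure_space (Y, d)"
    and f: "f \<in> X \<rightarrow>\<^sub>E Y"
  shows "continuous_map (X, c) (Y, d) f \<longleftrightarrow> (\<forall>x\<in>X. \<forall>y\<in>c {x}. f y \<in> d {f x})"
proof
  assume "continuous_map (X, c) (Y, d) f"
  then have "f ` c A \<subseteq> d (f ` A)" if "A \<subseteq> X" for A
    using that by (simp add: continuous_map_def)
  from this[of "{x}" for x] show "\<forall>x\<in>X. \<forall>y\<in>c {x}. f y \<in> d {f x}" by auto
next
  assume *: "\<forall>x\<in>X. \<forall>y\<in>c {x}. f y \<in> d {f x}"
  have "f y \<in> d (f ` A)" if "A \<subseteq> X" "y \<in> c A" for A y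
  proof -
    have "c A = (\<Union>x\<in>A. c {x})"
      using X(2) that(1) by (simp add: alexandroff_def)
    then obtain x where x: "x \<in> A" "y \<in> c {x}"
      using \<open>y \<in> c A\<close> by blast
    have "d {f x} \<subseteq> d (f ` A)"
      by (rule closure_space_mono[OF Y]) (use x that f in auto)
    then show ?thesis using * x that by blast
  qed
  then show "continuous_map (X, c) (Y, d) f"
    by (auto simp: continuous_map_def)
qed

section \<open>The constructions on closure spaces and graphs, on objects\<close>

lemma A_ob_closed:
  assumes "closure_space Y"
  shows "closure_space (A_ob Y)" "alexandroff (A_ob Y)"
proof -
  obtain X c where Y: "Y = (X, c)" by fastforce
  have "closure_space (X, \<lambda>A\<in>Pow X. \<Union>x\<in>A. c {x})"
    using assms
    by (intro closure_space_pointwise) (simp add: Y closure_space_refl closure_space_subset)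
  then show "closure_space (A_ob Y)" "alexandroff (A_ob Y)"
    by (simp_all add: Y A_ob_def alexandroff_pointwise)
qed

text \<open>Lying in each other's closure is a reflexive and symmetric relation for every closure
  operator; it supplies the point closures of \<open>s_ob\<close>.\<close>

lemma s_ob_closed:
  assumes "closure_space Y"
  shows "closure_space (s_ob Y)" "alexandroff (s_ob Y)" "symmetric (s_ob Y)"
proof -
  obtain X c where Y: "Y = (X, c)" by fastforce
  have "{y \<in> c {x}. x \<in> c {y}} \<subseteq> X" if "x \<in> X" for x
    using assms closure_space_point[of X c x] that by (auto simp: Y)
  then have "closure_space (X, \<lambda>A\<in>Pow X. \<Union>x\<in>A. {y \<in> c {x}. x \<in> c {y}})"
    using assms by (intro closure_space_pointwise) (simp add: Y closure_space_refl)
  then show "closure_space (s_ob Y)" "alexandroff (s_ob Y)" "symmetric (s_ob Y)"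
    by (simp_all add: Y s_ob_def alexandroff_pointwise) (simp add: symmetric_def)
qed

text \<open>Brings \<open>Psi_ob\<close> into the form to which the lemmas on unions of point
  closures apply.\<close>

lemma Psi_ob_pointwise: "Psi_ob (X, E) = (X, \<lambda>A\<in>Pow X. \<Union>x\<in>A. {y. (x, y) \<in> reflE (X, E)})"
  by (auto simp: Psi_ob_def fun_eq_iff)

lemma Psi_ob_closed:
  assumes "simple_graph G"
  shows "closure_space (Psi_ob G)" "alexandroff (Psi_ob G)" "symmetric (Psi_ob G)"
proof -
  obtain X E where G: "G = (X, E)" by fastforce
  show "closure_space (Psi_ob G)" "alexandroff (Psi_ob G)" "symmetric (Psi_ob G)"
    using assms unfolding G Psi_ob_pointwise
    by (auto simp: symmetric_def reflE_def simple_graph_def sym_def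
        intro!: closure_space_pointwise alexandroff_pointwise)
qed

lemma simple_graph_Phi_ob: "symmetric Y \<Longrightarrow> simple_graph (Phi_ob Y)"
  by (auto simp: symmetric_def simple_graph_def Phi_ob_def sym_def split: prod.splits)

text \<open>The diagonal that \<open>Phi_ob\<close> removes is restored by \<open>reflE\<close>,
  with no pair gained because \<open>x \<in> c {x}\<close>.\<close>

lemma reflE_Phi_ob:
  assumes "closure_space (X, c)"
  shows "(x, y) \<in> reflE (Phi_ob (X, c)) \<longleftrightarrow> x \<in> X \<and> y \<in> c {x}"
  using closure_space_refl[OF assms] closure_space_subset[OF assms, of "{x}"]
  by (auto simp: reflE_def Phi_ob_def)

text \<open>By \<open>reflE_Phi_ob\<close> the point closures are recovered; the Alexandroff
  property extends this to all subsets, and extensionality on \<open>Pow X\<close> gives equality of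
  functions.\<close>

lemma Psi_Phi_ob:
  assumes "closure_space Y" "alexandroff Y"
  shows "Psi_ob (Phi_ob Y) = Y"
proof -
  obtain X c where Y: "Y = (X, c)" by fastforce
  have eq: "Psi_ob (Phi_ob Y) = (X, \<lambda>A\<in>Pow X. {y. \<exists>x\<in>A. (x, y) \<in> reflE (Phi_ob Y)})"
    by (simp add: Y Psi_ob_def Phi_ob_def)
  have "(\<lambda>A\<in>Pow X. {y. \<exists>x\<in>A. (x, y) \<in> reflE (Phi_ob Y)}) = c"
  proof (rule extensionalityI[OF restrict_extensional closure_space_extensional])
    fix A assume A: "A \<in> Pow X"
    then have "c A = (\<Union>x\<in>A. c {x})"
      using assms(2) by (simp add: Y alexandroff_def)
    then show "(\<lambda>A\<in>Pow X. {y. \<exists>x\<in>A. (x, y) \<in> reflE (Phi_ob Y)}) A = c A"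
      using A reflE_Phi_ob[of X c] assms(1) by (auto simp: Y)
  qed (use assms Y in simp)
  then show ?thesis using eq Y by simp
qed

lemma Phi_Psi_ob: "simple_graph G \<Longrightarrow> Phi_ob (Psi_ob G) = G"
  by (auto simp: simple_graph_def Phi_ob_def Psi_ob_def reflE_def split: prod.splits)

section \<open>The transposition equivalences for closure spaces\<close>

lemma continuous_A_ob_iff:
  assumes "closure_space X" "alexandroff X" "closure_space Y" "f \<in> fst X \<rightarrow>\<^sub>E fst Y"
  shows "continuous_map X Y f \<longleftrightarrow> continuous_map X (A_ob Y) f"
proof -
  obtain S c T d where *: "X = (S, c)" "Y = (T, d)" by fastforce
  \<comment> \<open>\<open>A_ob\<close> leaves the closures of points unchanged, and the pointwise
    criterion, applied to both sides, sees only those.\<close>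
  show ?thesis
    using assms A_ob_closed[OF assms(3)] unfolding * A_ob_def prod.case
    by (subst (1 2) alexandroff_continuous_iff) (auto simp: PiE_iff)
qed

text \<open>In a symmetric source \<open>y \<in> c {x}\<close> comes with
  \<open>x \<in> c {y}\<close>. Applying the pointwise criterion to both pairs puts
  \<open>f x\<close> and \<open>f y\<close> in each other's closure, as \<open>s_ob\<close>
  demands.\<close>

lemma continuous_s_ob_iff:
  assumes X: "closure_space X" "alexandroff X" "symmetric X" and Y: "closure_space Y"
    and f: "f \<in> fst X \<rightarrow>\<^sub>E fst Y"
  shows "continuous_map X Y f \<longleftrightarrow> continuous_map X (s_ob Y) f"
proof -
  obtain S c T d where *: "X = (S, c)" "Y = (T, d)" by fastforce
  define d' where "d' = snd (s_ob Y)"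
  have s: "s_ob Y = (T, d')" "closure_space (T, d')"
    using s_ob_closed(1)[OF Y] by (simp_all add: * d'_def s_ob_def)
  have fT: "f x \<in> T" if "x \<in> S" for x
    using f that by (auto simp: *)
  \<comment> \<open>\<open>y \<in> S\<close> is what allows the criterion to be used at
    \<open>y\<close> for the reversed pair.\<close>
  have sym: "y \<in> S" "x \<in> c {y}" if "x \<in> S" "y \<in> c {x}" for x y
  proof -
    show "y \<in> S"
      using X(1) that closure_space_point by (simp add: *)
    then show "x \<in> c {y}"
      using X(3) that by (simp add: * symmetric_def)
  qed
  have "f y \<in> d' {f x} \<longleftrightarrow> f y \<in> d {f x} \<and> f x \<in> d {f y}" if "x \<in> S" for x y
    using fT[OF that] by (simp add: * d'_def s_ob_def)
  then have "(\<forall>x\<in>S. \<forall>y\<in>c {x}. f y \<in> d {f x}) \<longleftrightarrow> (\<forall>x\<in>S. \<forall>y\<in>c {x}. f y \<in> d' {f x})"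
    using sym by meson
  moreover have "f \<in> S \<rightarrow>\<^sub>E T"
    using f by (simp add: *)
  ultimately show ?thesis
    using X Y s(2) unfolding s(1) by (simp add: * alexandroff_continuous_iff)
qed

text \<open>Both sides say that \<open>x\<close> adjacent or equal to \<open>y\<close> implies
  \<open>f y \<in> d {f x}\<close>: on the left by the pointwise criterion, on the right by
  \<open>reflE_Phi_ob\<close>.\<close>

lemma continuous_Psi_ob_iff:
  assumes "simple_graph G" "closure_space Y" "f \<in> fst G \<rightarrow>\<^sub>E fst Y"
  shows "continuous_map (Psi_ob G) Y f \<longleftrightarrow> graph_hom G (Phi_ob Y) f"
proof -
  obtain X E T d where *: "G = (X, E)" "Y = (T, d)" by fastforce
  \<comment> \<open>The criterion ranges over points of \<open>X\<close>, but
    \<open>graph_hom\<close> over all pairs.\<close>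
  have "x \<in> X" if "(x, y) \<in> reflE (X, E)" for x y
    using that assms(1) by (auto simp: * reflE_def simple_graph_def)
  then show ?thesis
    using assms Psi_ob_closed[OF assms(1)] reflE_Phi_ob[of T d]
    unfolding * Psi_ob_pointwise graph_hom_def
    by (subst alexandroff_continuous_iff) (auto simp: PiE_iff)
qed

section \<open>Closure spaces and graphs form categories\<close>

lemma concrete_category_Cl: "concrete_category {A. closure_space A} continuous_map"
proof
  fix A :: "'a closure" assume "A \<in> {A. closure_space A}"
  moreover have "(\<lambda>x\<in>X. x) ` T = T" if "T \<subseteq> X" for T X :: "'a set"
    using that by force
  ultimately show "continuous_map A A (\<lambda>x\<in>fst A. x)"
    by (cases A) (simp add: continuous_map_def closure_space_subset)
next
  fix A B C :: "'a closure" and f g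
  assume "A \<in> {A. closure_space A}" and f: "f \<in> fst A \<rightarrow>\<^sub>E fst B"
    and cont: "continuous_map A B f" "continuous_map B C g"
  obtain X c Y d Z e where *: "A = (X, c)" "B = (Y, d)" "C = (Z, e)" by (metis surj_pair)
  have "compose X g f ` c S \<subseteq> e (compose X g f ` S)" if S: "S \<subseteq> X" for S
  proof -
    \<comment> \<open>\<open>compose X g f\<close> agrees with \<open>g\<close> after
      \<open>f\<close> only on \<open>X\<close>, so this is applied to \<open>S\<close> and to
      \<open>c S\<close> once both are known to lie in \<open>X\<close>.\<close>
    have img: "compose X g f ` T = g ` f ` T" if "T \<subseteq> X" for T
      using that by (force simp: compose_def)
    have "c S \<subseteq> X"
      using \<open>A \<in> _\<close> S by (simp add: * closure_space_subset)
    moreover have "f ` c S \<subseteq> d (f ` S)"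
      using cont(1) S by (simp add: * continuous_map_def)
    moreover have "f ` S \<subseteq> Y"
      using f S by (auto simp: *)
    then have "g ` d (f ` S) \<subseteq> e (g ` f ` S)"
      using cont(2) by (simp add: * continuous_map_def)
    ultimately show ?thesis
      unfolding img[OF \<open>c S \<subseteq> X\<close>] img[OF S] by (meson image_mono order_trans)
  qed
  then show "continuous_map A C (compose (fst A) g f)"
    by (simp add: * continuous_map_def)
qed

lemma concrete_category_Gph: "concrete_category {G. simple_graph G} graph_hom"
proof -
  \<comment> \<open>Places the ends of every reflexive edge where the restricted maps take their
    actual values.\<close>
  have "x \<in> fst G \<and> y \<in> fst G" if "simple_graph G" "(x, y) \<in> reflE G" for G :: "'a graph" and x y
    using that by (auto simp: simple_graph_def reflE_def split: prod.splits)
  then show ?thesis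
    by unfold_locales (auto simp: graph_hom_def compose_def)
qed


section \<open>Hypergraphs\<close>

lemma concrete_category_HypGph: "concrete_category {H. is_hypergraph H} hypergraph_hom"
proof
  fix A :: "'a hypergraph" assume "A \<in> {H. is_hypergraph H}"
  moreover have "(\<lambda>x\<in>X. x) ` T = T" if "T \<subseteq> X" for T X :: "'a set"
    using that by force
  ultimately show "hypergraph_hom A A (\<lambda>x\<in>fst A. x)"
    by (cases A) (auto simp: hypergraph_hom_def is_hypergraph_def subset_iff)
next
  fix A B C :: "'a hypergraph" and f g
  assume "A \<in> {H. is_hypergraph H}" "hypergraph_hom A B f" "hypergraph_hom B C g"
  moreover have "compose X g f ` T = g ` f ` T" if "T \<subseteq> X" for T X
    using that by (force simp: compose_def)
  ultimately show "hypergraph_hom A C (compose (fst A) g f)"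
    by (cases A; cases B; cases C) (auto simp: hypergraph_hom_def is_hypergraph_def subset_iff)
qed

section \<open>Graphs and simplicial complexes\<close>

lemma tr1_ob_simple_graph: "is_hypergraph H \<Longrightarrow> simple_graph (tr1_ob H)"
  by (auto simp: is_hypergraph_def simple_graph_def tr1_ob_def rel_of_edges_def sym_def
      insert_commute split: prod.splits)

lemma cosk1_ob_closed: "is_hypergraph (cosk1_ob G)" "simplicial_complex (cosk1_ob G)"
  by (auto simp: is_hypergraph_def simplicial_complex_def downward_closed_def cosk1_ob_def
      intro: finite_subset split: prod.splits)

text \<open>Two points in the image of a simplex \<open>e\<close> come from \<open>x\<close>,
  \<open>y\<close> in \<open>e\<close>, and \<open>{x, y}\<close> is a simplex by downward closure.
  Thus preserving edges already makes images of simplices cliques.\<close>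

lemma tr1_ob_iff:
  assumes H: "is_hypergraph H" "simplicial_complex H" and f: "f \<in> fst H \<rightarrow>\<^sub>E fst G"
  shows "graph_hom (tr1_ob H) G f \<longleftrightarrow> hypergraph_hom H (cosk1_ob G) f"
proof -
  obtain X E Y F where *: "H = (X, E)" "G = (Y, F)" by fastforce
  have sub: "e \<subseteq> X" "e \<noteq> {}" "finite e" if "e \<in> E" for e
    using H that by (auto simp: * is_hypergraph_def simplicial_complex_def)
  have dc: "\<sigma> \<in> E" if "e \<in> E" "\<sigma> \<subseteq> e" "\<sigma> \<noteq> {}" for e \<sigma>
    using H that by (auto simp: * simplicial_complex_def downward_closed_def)
  have edge: "(x, y) \<in> reflE (tr1_ob H) \<longleftrightarrow> (x = y \<and> x \<in> X) \<or> (x \<noteq> y \<and> {x, y} \<in> E)" for x y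
    by (auto simp: * reflE_def tr1_ob_def rel_of_edges_def)
  have fY: "f x \<in> Y" if "x \<in> X" for x
    using f that by (auto simp: *)
  show ?thesis
  proof
    assume hom: "graph_hom (tr1_ob H) G f"
    \<comment> \<open>\<open>f x \<noteq> f y\<close> forces \<open>x \<noteq> y\<close>, and it
      lets the diagonal part of \<open>reflE G\<close> be discarded.\<close>
    have "(f x, f y) \<in> F" if "e \<in> E" "x \<in> e" "y \<in> e" "f x \<noteq> f y" for e x y
    proof -
      have "{x, y} \<in> E" using dc[of e "{x, y}"] that by auto
      then have "(f x, f y) \<in> reflE G"
        using hom edge that by (auto simp: graph_hom_def)
      then show ?thesis using that by (auto simp: * reflE_def)
    qed
    then show "hypergraph_hom H (cosk1_ob G) f"
      using sub fY unfolding * hypergraph_hom_def cosk1_ob_def by fastforce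
  next
    assume hom: "hypergraph_hom H (cosk1_ob G) f"
    have "(f x, f y) \<in> reflE G" if "{x, y} \<in> E" for x y
    \<comment> \<open>A collapsed edge lands on the diagonal of \<open>reflE G\<close>, about which
      \<open>cosk1_ob\<close> says nothing.\<close>
    proof (cases "f x = f y")
      case True
      then show ?thesis
        using fY sub[OF that] by (auto simp: * reflE_def)
    next
      case False
      then show ?thesis
        using hom that by (auto simp: * hypergraph_hom_def cosk1_ob_def reflE_def)
    qed
    then show "graph_hom (tr1_ob H) G f"
      using fY unfolding graph_hom_def edge by (auto simp: * reflE_def)
  qed
qed

section \<open>Simplicial complexes and downward closed hypergraphs\<close>

lemma tr_inf_ob_closed:
  assumes "is_hypergraph H" "downward_closed H"
  shows "is_hypergraph (tr_inf_ob H)" "simplicial_complex (tr_inf_ob H)"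
proof -
  obtain X E where H: "H = (X, E)" by fastforce
  have "\<sigma> \<in> E \<and> finite \<sigma>" if "\<tau> \<in> E" "finite \<tau>" "\<sigma> \<noteq> {}" "\<sigma> \<subseteq> \<tau>" for \<sigma> \<tau>
    using assms(2) that finite_subset[of \<sigma> \<tau>] unfolding H downward_closed_def by blast
  moreover have "{x} \<in> E" if "x \<in> X" for x
    using assms(2) that by (simp add: H downward_closed_def)
  ultimately show "simplicial_complex (tr_inf_ob H)"
    by (simp add: H simplicial_complex_def downward_closed_def tr_inf_ob_def) blast
  show "is_hypergraph (tr_inf_ob H)"
    using assms(1) by (auto simp: H is_hypergraph_def tr_inf_ob_def)
qed

lemma is_hypergraph_cosk_inf_ob: "is_hypergraph (cosk_inf_ob H)"
  by (auto simp: is_hypergraph_def cosk_inf_ob_def split: prod.splits)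

text \<open>Finite subsets of \<open>\<sigma>\<close> are finite subsets of \<open>\<tau>\<close>,
  so the defining condition is inherited. For \<open>{x}\<close> the only nonempty subset to test is
  \<open>{x}\<close> itself.\<close>

lemma downward_closed_cosk_inf_ob:
  assumes "downward_closed H"
  shows "downward_closed (cosk_inf_ob H)"
proof -
  obtain X E where H: "H = (X, E)" by fastforce
  have mem: "\<tau> \<in> snd (cosk_inf_ob H) \<longleftrightarrow>
      \<tau> \<subseteq> X \<and> \<tau> \<noteq> {} \<and> (\<forall>\<sigma>. \<sigma> \<subseteq> \<tau> \<and> \<sigma> \<noteq> {} \<and> finite \<sigma> \<longrightarrow> \<sigma> \<in> E)" for \<tau>
    by (simp add: H cosk_inf_ob_def)
  have "\<sigma> \<in> snd (cosk_inf_ob H)" if \<tau>: "\<tau> \<in> snd (cosk_inf_ob H)" and \<sigma>: "\<sigma> \<noteq> {}" "\<sigma> \<subseteq> \<tau>"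
    for \<sigma> \<tau>
  proof -
    have "\<rho> \<in> E" if "\<rho> \<subseteq> \<sigma>" "\<rho> \<noteq> {}" "finite \<rho>" for \<rho>
      using \<tau> that order_trans[OF that(1) \<sigma>(2)] by (simp add: mem)
    moreover have "\<sigma> \<subseteq> X"
      using \<tau> order_trans[OF \<sigma>(2)] by (simp add: mem)
    ultimately show ?thesis
      using \<sigma>(1) by (simp add: mem)
  qed
  moreover have "{x} \<in> snd (cosk_inf_ob H)" if "x \<in> X" for x
  proof -
    have "{x} \<in> E"
      using assms that by (simp add: H downward_closed_def)
    then show ?thesis
      using that by (auto simp: mem subset_singleton_iff)
  qed
  moreover have "fst (cosk_inf_ob H) = X"
    by (simp add: H cosk_inf_ob_def)
  ultimately show ?thesis
    by (simp add: downward_closed_def split_def)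
qed

lemma simplicial_complex_downward_closed: "simplicial_complex H \<Longrightarrow> downward_closed H"
  by (simp add: simplicial_complex_def)

text \<open>A finite subset of the image of \<open>e\<close> is the image of a finite subset of
  \<open>e\<close>, which is a hyperedge by downward closure. Conversely, if \<open>e\<close> is
  finite, its image is one of its own finite subsets to be tested.\<close>

lemma tr_inf_ob_iff:
  assumes H: "is_hypergraph H" "downward_closed H" and f: "f \<in> fst H \<rightarrow>\<^sub>E fst K"
  shows "hypergraph_hom (tr_inf_ob H) K f \<longleftrightarrow> hypergraph_hom H (cosk_inf_ob K) f"
proof -
  obtain X E Y F where *: "H = (X, E)" "K = (Y, F)" by fastforce
  have sub: "e \<subseteq> X" "e \<noteq> {}" if "e \<in> E" for e
    using H that by (auto simp: * is_hypergraph_def)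
  have dc: "\<sigma> \<in> E" if "e \<in> E" "\<sigma> \<subseteq> e" "\<sigma> \<noteq> {}" for e \<sigma>
    using H that by (auto simp: * downward_closed_def)
  show ?thesis
  proof
    assume hom: "hypergraph_hom (tr_inf_ob H) K f"
    have "\<sigma> \<in> F" if \<sigma>: "e \<in> E" "\<sigma> \<subseteq> f ` e" "\<sigma> \<noteq> {}" "finite \<sigma>" for e \<sigma>
    proof -
      obtain \<rho> where "\<rho> \<subseteq> e" "finite \<rho>" "\<sigma> = f ` \<rho>"
        using finite_subset_image[OF \<sigma>(4,2)] by blast
      moreover from this have "\<rho> \<in> E"
        using dc \<sigma> by blast
      ultimately show ?thesis
        using hom by (simp add: * hypergraph_hom_def tr_inf_ob_def)
    qed
    moreover have "f ` e \<subseteq> Y" "f ` e \<noteq> {}" if "e \<in> E" for e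
      using sub[OF that] f by (auto simp: *)
    ultimately show "hypergraph_hom H (cosk_inf_ob K) f"
      by (auto simp: * hypergraph_hom_def cosk_inf_ob_def)
  next
    assume "hypergraph_hom H (cosk_inf_ob K) f"
    then show "hypergraph_hom (tr_inf_ob H) K f"
      by (auto simp: * hypergraph_hom_def cosk_inf_ob_def tr_inf_ob_def)
  qed
qed

section \<open>Downward closure of hypergraphs\<close>

lemma is_hypergraph_dc_ob: "is_hypergraph H \<Longrightarrow> is_hypergraph (dc_ob H)"
  by (auto simp: is_hypergraph_def dc_ob_def split: prod.splits)

lemma downward_closed_dc_ob: "downward_closed (dc_ob H)"
proof -
  obtain X E where H: "H = (X, E)" by fastforce
  have "\<sigma> \<in> snd (dc_ob H)" if "\<tau> \<in> snd (dc_ob H)" "\<sigma> \<noteq> {}" "\<sigma> \<subseteq> \<tau>" for \<sigma> \<tau>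
    using that(1)[unfolded H dc_ob_def prod.case snd_conv]
  proof
    assume "\<tau> \<in> {\<tau>. \<tau> \<noteq> {} \<and> (\<exists>e\<in>E. \<tau> \<subseteq> e)}"
    then show ?thesis
      using that(2,3) order_trans unfolding H dc_ob_def by fastforce
  next
    assume "\<tau> \<in> {{x} |x. x \<in> X}"
    then show ?thesis
      using that(2,3) by (auto simp: H dc_ob_def subset_singleton_iff)
  qed
  then show ?thesis
    by (auto simp: H dc_ob_def downward_closed_def)
qed

text \<open>A hyperedge added by \<open>dc_ob\<close> is a nonempty subset of an old one or a
  singleton; downward closure of \<open>K\<close> accepts both images. Old hyperedges survive since
  they are nonempty.\<close>

lemma dc_ob_iff:
  assumes H: "is_hypergraph H" and K: "downward_closed K" and f: "f \<in> fst H \<rightarrow>\<^sub>E fst K"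
  shows "hypergraph_hom (dc_ob H) K f \<longleftrightarrow> hypergraph_hom H K f"
proof -
  obtain X E Y F where *: "H = (X, E)" "K = (Y, F)" by fastforce
  have dc: "f ` \<sigma> \<in> F" if "f ` e \<in> F" "\<sigma> \<subseteq> e" "\<sigma> \<noteq> {}" for e \<sigma>
    using K that image_mono[OF that(2), of f] by (auto simp: * downward_closed_def)
  have "{f x} \<in> F" if "x \<in> X" for x
    using K f that by (auto simp: * downward_closed_def)
  with dc have "f ` \<sigma> \<in> F" if "\<forall>e\<in>E. f ` e \<in> F" "\<sigma> \<in> snd (dc_ob H)" for \<sigma>
    using that by (auto simp: * dc_ob_def)
  moreover have "E \<subseteq> snd (dc_ob H)"
    using H by (auto simp: * dc_ob_def is_hypergraph_def)
  ultimately show ?thesis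
    unfolding * hypergraph_hom_def dc_ob_def by auto
qed


section \<open>The chain of adjunctions\<close>

text \<open>Rewrites all categories and inclusions of the chain into the concrete form on which the
  general lemmas work.\<close>

lemmas concrete_cat_simps =
  Cl_def Cl_A_def Cl_sA_def Gph_def HypGph_def HypGph_dc_def Simp_def
  full_subcat_concrete_cat incl_eq_concrete_functor

lemmas concrete_category_intros =
  concrete_category_Cl concrete_category_Gph concrete_category_HypGph
  concrete_category_Cl[THEN concrete_category.subcategory]
  concrete_category_HypGph[THEN concrete_category.subcategory]

lemma fst_ob [simp]:
  "fst (A_ob Y) = fst Y" "fst (s_ob Y) = fst Y" "fst (Phi_ob Y) = fst Y" "fst (Psi_ob G) = fst G"
  "fst (tr1_ob H) = fst H" "fst (cosk1_ob G) = fst G" "fst (tr_inf_ob H) = fst H"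
  "fst (cosk_inf_ob H) = fst H" "fst (dc_ob H) = fst H"
  by (auto simp: A_ob_def s_ob_def Phi_ob_def Psi_ob_def tr1_ob_def cosk1_ob_def tr_inf_ob_def
      cosk_inf_ob_def dc_ob_def split: prod.splits)

lemma right_adjoint_A: "right_adjoint Cl Cl_A A_fun incl"
  unfolding concrete_cat_simps
  \<comment> \<open>\<open>intro\<close> settles the two category premises; the object conditions
    and the equivalence \<open>adj\<close> remain for \<open>auto\<close>.\<close>
  by (rule right_adjoint_concrete_functor; (intro concrete_category_intros)?)
    (auto simp: A_ob_closed continuous_A_ob_iff)

lemma right_adjoint_s: "right_adjoint Cl_A Cl_sA s_fun incl"
  unfolding concrete_cat_simps
  by (rule right_adjoint_concrete_functor; (intro concrete_category_intros)?)
    (auto simp: s_ob_closed continuous_s_ob_iff)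

lemma inverse_functors_Phi_Psi: "inverse_functors Cl_sA Gph Phi Psi"
  unfolding concrete_cat_simps
  by (rule inverse_functors_concrete_functor; (intro concrete_category_intros)?)
    (auto simp: Psi_ob_closed simple_graph_Phi_ob continuous_Psi_ob_iff Psi_Phi_ob Phi_Psi_ob)

text \<open>Recasts the isomorphism as an adjunction so that it can be a link of the
  composite.\<close>

lemma right_adjoint_Phi: "right_adjoint Cl_sA Gph Phi Psi"
  unfolding concrete_cat_simps
  by (rule right_adjoint_concrete_functor; (intro concrete_category_intros)?)
    (auto simp: Psi_ob_closed simple_graph_Phi_ob continuous_Psi_ob_iff)

lemma right_adjoint_cosk1: "right_adjoint Gph Simp cosk1 tr1"
  unfolding concrete_cat_simps
  by (rule right_adjoint_concrete_functor; (intro concrete_category_intros)?)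
    (auto simp: tr1_ob_simple_graph cosk1_ob_closed tr1_ob_iff)

lemma right_adjoint_cosk_inf: "right_adjoint Simp HypGph_dc cosk_inf tr_inf"
  unfolding concrete_cat_simps
  by (rule right_adjoint_concrete_functor; (intro concrete_category_intros)?)
    (auto simp: tr_inf_ob_closed is_hypergraph_cosk_inf_ob downward_closed_cosk_inf_ob
      tr_inf_ob_iff simplicial_complex_downward_closed)

lemma right_adjoint_incl: "right_adjoint HypGph_dc HypGph incl dc"
  unfolding concrete_cat_simps
  by (rule right_adjoint_concrete_functor; (intro concrete_category_intros)?)
    (auto simp: is_hypergraph_dc_ob downward_closed_dc_ob dc_ob_iff)

text \<open>Nesting \<open>right_adjoint_comp\<close> brackets the right adjoints to the left,
  whereas \<open>\<circ>\<^sub>F\<close> associates to the right.\<close>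

lemma fctr_comp_assoc: "(H \<circ>\<^sub>F G) \<circ>\<^sub>F F = H \<circ>\<^sub>F G \<circ>\<^sub>F F"
  by (simp add: fctr_comp_def comp_assoc)

theorem theorem6p5:
  shows "right_adjoint (Cl :: 'a closure_cat) Cl_A A_fun incl
    \<and> right_adjoint (Cl_A :: 'a closure_cat) Cl_sA s_fun incl
    \<and> inverse_functors (Cl_sA :: 'a closure_cat) Gph Phi Psi
    \<and> right_adjoint (Cl_sA :: 'a closure_cat) Gph Phi Psi
    \<and> right_adjoint (Gph :: 'a graph_cat) Simp cosk1 tr1
    \<and> right_adjoint (Simp :: 'a hypergraph_cat) HypGph_dc cosk_inf tr_inf
    \<and> right_adjoint (HypGph_dc :: 'a hypergraph_cat) HypGph incl dc
    \<and> right_adjoint (Cl :: 'a closure_cat) HypGph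
        (incl \<circ>\<^sub>F cosk_inf \<circ>\<^sub>F cosk1 \<circ>\<^sub>F Phi \<circ>\<^sub>F s_fun \<circ>\<^sub>F A_fun)
        (incl \<circ>\<^sub>F incl \<circ>\<^sub>F Psi \<circ>\<^sub>F tr1 \<circ>\<^sub>F tr_inf \<circ>\<^sub>F dc)"
proof (intro conjI)
  show "right_adjoint (Cl :: 'a closure_cat) HypGph
        (incl \<circ>\<^sub>F cosk_inf \<circ>\<^sub>F cosk1 \<circ>\<^sub>F Phi \<circ>\<^sub>F s_fun \<circ>\<^sub>F A_fun)
        (incl \<circ>\<^sub>F incl \<circ>\<^sub>F Psi \<circ>\<^sub>F tr1 \<circ>\<^sub>F tr_inf \<circ>\<^sub>F dc)"
    using right_adjoint_comp[OF right_adjoint_A right_adjoint_comp[OF right_adjoint_s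
        right_adjoint_comp[OF right_adjoint_Phi right_adjoint_comp[OF right_adjoint_cosk1
        right_adjoint_comp[OF right_adjoint_cosk_inf right_adjoint_incl]]]]]
    by (simp add: fctr_comp_assoc)
qed (fact right_adjoint_A right_adjoint_s inverse_functors_Phi_Psi right_adjoint_Phi
    right_adjoint_cosk1 right_adjoint_cosk_inf right_adjoint_incl)+

end
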